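(* Let $\Phi$ be a derivation in system $\mathcal{N}$ of $\Gamma \vdash^{(m,e,s)} t : \sigma$, and suppose $\Phi$ is tight. Then there exists a term $p \in \mathsf{no}_{n}$ such that $t \to_{n}^{(m,e)} p$, i.e.\ $t$ reduces to $p$ by $\to_n$ using exactly $m$ multiplicative steps and exactly $e$ exponential steps, and $|p|_{n} = s$.
   Context: Terms. Fix a countably infinite set of variables. Terms are $t,u,r ::= x \mid \lambda x.t \mid t\,u \mid t[x\backslash u]$, where $t[x\backslash u]$ (an explicit substitution) binds $x$ in $t$; terms are taken modulo $\alpha$-conversion and $t\{x:=u\}$ denotes capture-avoiding meta-level substitution. List contexts are $L ::= \square \mid L[x\backslash t]$, and $L\langle t\rangle$ is the result of plugging $t$ into the hole. CBN neutral and normal terms: $\mathsf{ne}_n ::= x \mid \mathsf{ne}_n\, t$ and $\mathsf{no}_n ::= \lambda x.\mathsf{no}_n \mid \mathsf{ne}_n$. The $n$-size is $|x|_n=0$, $|\lambda x.t|_n = |t|_n+1$, $|t\,u|_n = |t|_n+1$, $|t[x\backslash u]|_n = |t|_n$. Reduction. Rule $\mathtt{dB}$: $(L\langle \lambda x.t\rangle)\,u \mapsto L\langle t[x\backslash u]\rangle$; rule $\mathtt{sn}$: $t[x\backslash u] \mapsto t\{x:=u\}$. CBN contexts are $N ::= \square \mid N\,t \mid \lambda x.N \mid N[x\backslash u]$, and $\to_n$ is the closure of $\mathtt{dB}\cup\mathtt{sn}$ under CBN contexts. $\mathtt{dB}$-steps are multiplicative ($m$-steps), $\mathtt{sn}$-steps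 are exponential ($e$-steps). $t \to_n^{(m,e)} p$ means $t$ reduces to $p$ in finitely many $\to_n$ steps, exactly $m$ of which are $m$-steps and $e$ of which are $e$-steps. Types. Tight types: $\mathtt{tt} ::= \mathtt{n} \mid \mathtt{a}$. Types: $\sigma,\tau ::= \mathtt{tt} \mid \mathcal{M} \mid \mathcal{M}\to\sigma$, where multitypes $\mathcal{M} = [\sigma_i]_{i\in I}$ are finite multisets of types ($[\,]$ empty, $\sqcup$ union). A typing context $\Gamma$ maps variables to multitypes, $[\,]$ for all but finitely many; $\mathrm{dom}(\Gamma)=\{x \mid \Gamma(x)\neq[\,]\}$; $(\Gamma+\Delta)(x) = \Gamma(x)\sqcup\Delta(x)$, extended to finite sums $+_{i\in I}\Gamma_i$ (the empty context if $I=\emptyset$); $\Gamma\setminus\!\!\setminus x$ maps $x$ to $[\,]$ and agrees with $\Gamma$ elsewhere; $\Gamma; x:\mathcal{M}$ is the context mapping $x$ to $\mathcal{M}$ and agreeing with $\Gamma$ elsewhere, where $x\notin\mathrm{dom}(\Gamma)$. Judgements $\Gamma \vdash^{(m,e,s)} t:\sigma$ carry natural-number counters. System $\mathcal{N}$ consists of the rules: (app$_p$) from $\Gamma\vdash^{(m,e,s)} t:\mathtt{n}$ infer $\Gamma\vdash^{(m,e,s+1)} t\,u:\mathtt{n}$; (abs$_p$) from $\Gamma\vdash^{(m,e,s)} t:\mathtt{tt}$ (a tight type) with $\Gamma(x)$ tight, infer $\Gamma\setminus\!\!\setminus x\vdash^{(m,e,s+1)}\lambda x.t:\mathtt{a}$;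 (var$_c$) $x:[\sigma]\vdash^{(0,0,0)} x:\sigma$; (abs$_c$) from $\Gamma\vdash^{(m,e,s)} t:\tau$ infer $\Gamma\setminus\!\!\setminus x\vdash^{(m,e,s)}\lambda x.t:\Gamma(x)\to\tau$; (app$_c$) from $\Gamma\vdash^{(m,e,s)} t:[\sigma_i]_{i\in I}\to\tau$ and $\Delta_i\vdash^{(m_i,e_i,s_i)} u:\sigma_i$ for each $i\in I$, infer $\Gamma+_{i\in I}\Delta_i\vdash^{(1+m+\sum_i m_i,\,1+e+\sum_i e_i,\,s+\sum_i s_i)} t\,u:\tau$; (es$_c$) from $\Gamma;x:[\sigma_i]_{i\in I}\vdash^{(m,e,s)} t:\tau$ and $\Delta_i\vdash^{(m_i,e_i,s_i)} u:\sigma_i$ for each $i\in I$, infer $(\Gamma\setminus\!\!\setminus x)+_{i\in I}\Delta_i\vdash^{(m+\sum_i m_i,\,1+e+\sum_i e_i,\,s+\sum_i s_i)} t[x\backslash u]:\tau$. A multitype is tight if all its elements are tight types; a context is tight if all multitypes it assigns are tight; a derivation of $\Gamma\vdash^{(m,e,s)} t:\sigma$ is tight if $\Gamma$ is tight and $\sigma$ is a tight type. *)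

theory Defs
  imports Main "HOL-Library.Multiset"
begin

text \<open>
  Terms modulo \<open>\<alpha>\<close>-conversion are represented by de Bruijn terms, the free variables being the
  dangling indices. \<open>Lam t\<close> and \<open>ES t u\<close> (the explicit substitution \<open>t[x\u]\<close>) bind index 0 in \<open>t\<close>;
  the argument \<open>u\<close> of \<open>ES t u\<close> is outside the scope of the binder.
\<close>

datatype trm =
    Var nat
  | Lam trm
  | App trm trm
  | ES trm trm

primrec lift :: "trm \<Rightarrow> nat \<Rightarrow> trm" where
  "lift (Var i) k = (if i < k then Var i else Var (Suc i))"
| "lift (Lam t) k = Lam (lift t (Suc k))"
| "lift (App t u) k = App (lift t k) (lift u k)"
| "lift (ES t u) k = ES (lift t (Suc k)) (lift u k)"

text \<open>
  \<open>subst t u k\<close> replaces index \<open>k\<close> by \<open>u\<close> and, since the binder of \<open>k\<close> disappears, decrements the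
  indices above \<open>k\<close>. Thus \<open>t{x:=u}\<close>, for \<open>t\<close> the body of a binder of \<open>x\<close>, is \<open>subst t u 0\<close>.
\<close>

primrec subst :: "trm \<Rightarrow> trm \<Rightarrow> nat \<Rightarrow> trm" where
  "subst (Var i) u k = (if k < i then Var (i - 1) else if i = k then u else Var i)"
| "subst (Lam t) u k = Lam (subst t (lift u 0) (Suc k))"
| "subst (App t r) u k = App (subst t u k) (subst r u k)"
| "subst (ES t r) u k = ES (subst t (lift u 0) (Suc k)) (subst r u k)"

datatype lctx = LHole | LES lctx trm

primrec lplug :: "lctx \<Rightarrow> trm \<Rightarrow> trm" where
  "lplug LHole t = t"
| "lplug (LES L u) t = ES (lplug L t) u"

primrec llength :: "lctx \<Rightarrow> nat" where
  "llength LHole = 0"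
| "llength (LES L u) = Suc (llength L)"

datatype nctx = NHole | NApp nctx trm | NLam nctx | NES nctx trm

primrec nplug :: "nctx \<Rightarrow> trm \<Rightarrow> trm" where
  "nplug NHole t = t"
| "nplug (NApp N u) t = App (nplug N t) u"
| "nplug (NLam N) t = Lam (nplug N t)"
| "nplug (NES N u) t = ES (nplug N t) u"

inductive_set ne\<^sub>n :: "trm set" and no\<^sub>n :: "trm set" where
  ne_var: "Var i \<in> ne\<^sub>n"
| ne_app: "t \<in> ne\<^sub>n \<Longrightarrow> App t u \<in> ne\<^sub>n"
| no_lam: "t \<in> no\<^sub>n \<Longrightarrow> Lam t \<in> no\<^sub>n"
| no_ne: "t \<in> ne\<^sub>n \<Longrightarrow> t \<in> no\<^sub>n"

primrec nsize :: "trm \<Rightarrow> nat" where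
  "nsize (Var i) = 0"
| "nsize (Lam t) = nsize t + 1"
| "nsize (App t u) = nsize t + 1"
| "nsize (ES t u) = nsize t"

text \<open>
  In the \<open>dB\<close> rule the argument \<open>u\<close> moves below the \<open>llength L\<close> binders of \<open>L\<close>, which must not
  capture its free variables; hence the iterated lifting.
\<close>

inductive dB :: "trm \<Rightarrow> trm \<Rightarrow> bool" where
  "dB (App (lplug L (Lam t)) u) (lplug L (ES t (((\<lambda>v. lift v 0) ^^ llength L) u)))"

inductive sn :: "trm \<Rightarrow> trm \<Rightarrow> bool" where
  "sn (ES t u) (subst t u 0)"

inductive mstep :: "trm \<Rightarrow> trm \<Rightarrow> bool" where
  "dB t t' \<Longrightarrow> mstep (nplug N t) (nplug N t')"

inductive estep :: "trm \<Rightarrow> trm \<Rightarrow> bool" where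
  "sn t t' \<Longrightarrow> estep (nplug N t) (nplug N t')"

inductive nred :: "trm \<Rightarrow> nat \<Rightarrow> nat \<Rightarrow> trm \<Rightarrow> bool"
    ("_ \<rightarrow>\<^sub>n'(_,_') _" [51, 0, 0, 51] 50) where
  nred_refl: "t \<rightarrow>\<^sub>n(0,0) t"
| nred_m: "mstep t r \<Longrightarrow> r \<rightarrow>\<^sub>n(m,e) p \<Longrightarrow> t \<rightarrow>\<^sub>n(Suc m,e) p"
| nred_e: "estep t r \<Longrightarrow> r \<rightarrow>\<^sub>n(m,e) p \<Longrightarrow> t \<rightarrow>\<^sub>n(m,Suc e) p"

datatype tight = TN | TA

datatype ty =
    Tight tight
  | Multi "ty multiset"
  | Arr "ty multiset" ty

type_synonym ctx = "nat \<Rightarrow> ty multiset"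

definition tight_ty :: "ty \<Rightarrow> bool" where
  "tight_ty \<sigma> \<longleftrightarrow> (\<exists>tt. \<sigma> = Tight tt)"

definition tight_multi :: "ty multiset \<Rightarrow> bool" where
  "tight_multi M \<longleftrightarrow> (\<forall>\<sigma> \<in># M. tight_ty \<sigma>)"

definition tight_ctx :: "ctx \<Rightarrow> bool" where
  "tight_ctx \<Gamma> \<longleftrightarrow> (\<forall>x. tight_multi (\<Gamma> x))"

text \<open>
  \<open>ctx_cons M \<Gamma>\<close> is \<open>\<Gamma>; x:M\<close> and \<open>ctx_tail \<Gamma>\<close> is \<open>\<Gamma>\<close> with \<open>x\<close> removed, where \<open>x\<close> is the variable
  bound by the enclosing binder (index 0): the indices of the remaining variables are shifted by one.
\<close>

definition ctx_cons :: "ty multiset \<Rightarrow> ctx \<Rightarrow> ctx" where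
  "ctx_cons M \<Gamma> = case_nat M \<Gamma>"

definition ctx_tail :: "ctx \<Rightarrow> ctx" where
  "ctx_tail \<Gamma> = (\<lambda>x. \<Gamma> (Suc x))"

definition ctx_single :: "nat \<Rightarrow> ty \<Rightarrow> ctx" where
  "ctx_single x \<sigma> = (\<lambda>y. if y = x then {#\<sigma>#} else {#})"

definition ctx_add_sum :: "ctx \<Rightarrow> nat set \<Rightarrow> (nat \<Rightarrow> ctx) \<Rightarrow> ctx" where
  "ctx_add_sum \<Gamma> I \<Delta> = (\<lambda>x. \<Gamma> x + (\<Sum>i\<in>I. \<Delta> i x))"

text \<open>
  The typing contexts of derivable judgements vanish almost everywhere without this being imposed
  (lemma \<open>finite_dom\<close> below). In \<open>es_c\<close> the context of the conclusion is \<open>\<Gamma>\<close>, read outside the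
  binder, because \<open>x\<close> is not in the domain of \<open>\<Gamma>\<close>.
\<close>

inductive typing :: "ctx \<Rightarrow> nat \<Rightarrow> nat \<Rightarrow> nat \<Rightarrow> trm \<Rightarrow> ty \<Rightarrow> bool"
    ("_ \<turnstile>'(_,_,_') _ : _" [51, 0, 0, 0, 51, 51] 50) where
  app_p:
    "\<Gamma> \<turnstile>(m,e,s) t : Tight TN \<Longrightarrow> \<Gamma> \<turnstile>(m,e,s+1) App t u : Tight TN"
| abs_p:
    "\<Gamma> \<turnstile>(m,e,s) t : Tight tt \<Longrightarrow> tight_multi (\<Gamma> 0) \<Longrightarrow>
     ctx_tail \<Gamma> \<turnstile>(m,e,s+1) Lam t : Tight TA"
| var_c:
    "ctx_single x \<sigma> \<turnstile>(0,0,0) Var x : \<sigma>"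
| abs_c:
    "\<Gamma> \<turnstile>(m,e,s) t : \<tau> \<Longrightarrow> ctx_tail \<Gamma> \<turnstile>(m,e,s) Lam t : Arr (\<Gamma> 0) \<tau>"
| app_c:
    "finite I \<Longrightarrow>
     \<Gamma> \<turnstile>(m,e,s) t : Arr {#\<sigma> i. i \<in># mset_set I#} \<tau> \<Longrightarrow>
     (\<And>i. i \<in> I \<Longrightarrow> \<Delta> i \<turnstile>(m' i,e' i,s' i) u : \<sigma> i) \<Longrightarrow>
     ctx_add_sum \<Gamma> I \<Delta>
       \<turnstile>(1 + m + (\<Sum>i\<in>I. m' i), 1 + e + (\<Sum>i\<in>I. e' i), s + (\<Sum>i\<in>I. s' i)) App t u : \<tau>"
| es_c:
    "finite I \<Longrightarrow>
     ctx_cons {#\<sigma> i. i \<in># mset_set I#} \<Gamma> \<turnstile>(m,e,s) t : \<tau> \<Longrightarrow>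
     (\<And>i. i \<in> I \<Longrightarrow> \<Delta> i \<turnstile>(m' i,e' i,s' i) u : \<sigma> i) \<Longrightarrow>
     ctx_add_sum \<Gamma> I \<Delta>
       \<turnstile>(m + (\<Sum>i\<in>I. m' i), 1 + e + (\<Sum>i\<in>I. e' i), s + (\<Sum>i\<in>I. s' i)) ES t u : \<tau>"

lemma finite_dom_tail:
  assumes "finite {x. \<Gamma> x \<noteq> {#}}"
  shows "finite {x. ctx_tail \<Gamma> x \<noteq> {#}}"
proof -
  have "{x. ctx_tail \<Gamma> x \<noteq> {#}} = Suc -` {x. \<Gamma> x \<noteq> {#}}"
    by (auto simp: ctx_tail_def)
  then show ?thesis using finite_vimageI[OF assms, of Suc] by (simp only: inj_Suc)
qed

lemma finite_dom_add_sum: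
  assumes "finite I" "finite {x. \<Gamma> x \<noteq> {#}}" "\<And>i. i \<in> I \<Longrightarrow> finite {x. \<Delta> i x \<noteq> {#}}"
  shows "finite {x. ctx_add_sum \<Gamma> I \<Delta> x \<noteq> {#}}"
proof (rule finite_subset)
  show "{x. ctx_add_sum \<Gamma> I \<Delta> x \<noteq> {#}} \<subseteq> {x. \<Gamma> x \<noteq> {#}} \<union> (\<Union>i\<in>I. {x. \<Delta> i x \<noteq> {#}})"
    using assms(1) by (auto simp: ctx_add_sum_def)
  show "finite ({x. \<Gamma> x \<noteq> {#}} \<union> (\<Union>i\<in>I. {x. \<Delta> i x \<noteq> {#}}))"
    using assms by simp
qed

lemma finite_dom: "\<Gamma> \<turnstile>(m,e,s) t : \<sigma> \<Longrightarrow> finite {x. \<Gamma> x \<noteq> {#}}"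
proof (induction rule: typing.induct)
  case (var_c x \<sigma>)
  have "{y. ctx_single x \<sigma> y \<noteq> {#}} = {x}" by (auto simp: ctx_single_def)
  then show ?case by simp
next
  case (es_c I \<sigma> \<Gamma> m e s t \<tau> \<Delta> m' e' s' u)
  have "\<Gamma> = ctx_tail (ctx_cons {#\<sigma> i. i \<in># mset_set I#} \<Gamma>)"
    by (simp add: ctx_tail_def ctx_cons_def)
  then have "finite {x. \<Gamma> x \<noteq> {#}}"
    using finite_dom_tail[OF es_c.IH(1)] by simp
  then show ?case using es_c by (intro finite_dom_add_sum) auto
qed (auto intro: finite_dom_tail finite_dom_add_sum)

end

theory Submission
  imports Defs "HOL-Library.Function_Algebras"
begin

text \<open>
  Since \<open>ES t u\<close> is itself an exponential redex, a term outside \<open>no\<^sub>n\<close> always has a step that does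
  not go below an explicit substitution and whose \<open>dB\<close> redex has an empty list context. For such a
  step subject reduction is exact: it lowers the counter of its kind by one and keeps the rest of
  the judgement. Iterating it, which terminates because \<open>m + e\<close> decreases, leads to a normal form,
  and a tight derivation of a normal form has the counters \<open>(0, 0, |p|\<^sub>n)\<close>.
\<close>

section \<open>Typing a term with a multitype\<close>

text \<open>One derivation of \<open>u\<close> per element of the multitype, with contexts and
  counters added up. This replaces the indexed families of \<open>app_c\<close> and
  \<open>es_c\<close>, so that arguments go by induction on the multitype instead of over index
  sets.\<close>

inductive multi_typing :: "ctx \<Rightarrow> nat \<Rightarrow> nat \<Rightarrow> nat \<Rightarrow> trm \<Rightarrow> ty multiset \<Rightarrow> bool"
    ("_ \<tturnstile>'(_,_,_') _ : _" [51, 0, 0, 0, 51, 51] 50) where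
  multi_empty: "0 \<tturnstile>(0,0,0) u : {#}"
| multi_add:
    "\<Delta> \<turnstile>(m,e,s) u : \<sigma> \<Longrightarrow> \<Delta>' \<tturnstile>(m',e',s') u : M \<Longrightarrow>
     \<Delta> + \<Delta>' \<tturnstile>(m + m',e + e',s + s') u : add_mset \<sigma> M"

inductive_cases multi_emptyE: "\<Delta> \<tturnstile>(m,e,s) u : {#}"

text \<open>A derivation lists the elements in some order; the premise for any chosen element can be
  moved outermost because sums of contexts and counters commute.\<close>

lemma multi_typing_add_msetE:
  assumes "\<Delta> \<tturnstile>(m,e,s) u : M" "\<sigma> \<in># M"
  obtains \<Delta>1 m1 e1 s1 \<Delta>2 m2 e2 s2 where
    "\<Delta>1 \<turnstile>(m1,e1,s1) u : \<sigma>" "\<Delta>2 \<tturnstile>(m2,e2,s2) u : M - {#\<sigma>#}"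
    "\<Delta> = \<Delta>1 + \<Delta>2" "m = m1 + m2" "e = e1 + e2" "s = s1 + s2"
  using assms
proof (induction arbitrary: thesis rule: multi_typing.induct)
  case (multi_empty u)
  then show ?case by simp
next
  case (multi_add \<Delta> m e s u \<tau> \<Delta>' m' e' s' M)
  show ?case
  proof (cases "\<sigma> = \<tau>")
    case True
    then show ?thesis using multi_add by auto
  next
    case False
    then have "\<sigma> \<in># M" using multi_add.prems(2) by simp
    from multi_add.IH[OF _ this]
    obtain \<Delta>1 m1 e1 s1 \<Delta>2 m2 e2 s2 where 1:
      "\<Delta>1 \<turnstile>(m1,e1,s1) u : \<sigma>" "\<Delta>2 \<tturnstile>(m2,e2,s2) u : M - {#\<sigma>#}"
      "\<Delta>' = \<Delta>1 + \<Delta>2" "m' = m1 + m2" "e' = e1 + e2" "s' = s1 + s2" by blast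
    have "\<Delta> + \<Delta>2 \<tturnstile>(m + m2,e + e2,s + s2) u : add_mset \<tau> M - {#\<sigma>#}"
      using multi_typing.multi_add[OF multi_add.hyps(1) 1(2)] False \<open>\<sigma> \<in># M\<close> by simp
    from multi_add.prems(1)[OF 1(1) this] 1 show ?thesis by (simp add: ac_simps)
  qed
qed

lemma multi_typing_singleD: "\<Delta> \<tturnstile>(m,e,s) u : {#\<sigma>#} \<Longrightarrow> \<Delta> \<turnstile>(m,e,s) u : \<sigma>"
  by (erule multi_typing_add_msetE[of _ _ _ _ _ _ \<sigma>]) (auto elim: multi_emptyE)

text \<open>Needed when a substituted variable occurs in two subterms: its multitype is then a sum,
  and the derivations of \<open>u\<close> have to be distributed between them.\<close>

lemma multi_typing_plusE:
  assumes "\<Delta> \<tturnstile>(m,e,s) u : M + N"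
  obtains \<Delta>1 m1 e1 s1 \<Delta>2 m2 e2 s2 where
    "\<Delta>1 \<tturnstile>(m1,e1,s1) u : M" "\<Delta>2 \<tturnstile>(m2,e2,s2) u : N"
    "\<Delta> = \<Delta>1 + \<Delta>2" "m = m1 + m2" "e = e1 + e2" "s = s1 + s2"
  using assms
proof (induction M arbitrary: thesis \<Delta> m e s)
  case empty
  then show ?case using multi_empty by fastforce
next
  case (add \<sigma> M)
  obtain \<Delta>1 m1 e1 s1 \<Delta>2 m2 e2 s2 where 1:
    "\<Delta>1 \<turnstile>(m1,e1,s1) u : \<sigma>" "\<Delta>2 \<tturnstile>(m2,e2,s2) u : M + N"
    "\<Delta> = \<Delta>1 + \<Delta>2" "m = m1 + m2" "e = e1 + e2" "s = s1 + s2"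
    by (rule multi_typing_add_msetE[OF add.prems(2), of \<sigma>]) (simp, rule that, simp_all)
  obtain \<Delta>3 m3 e3 s3 \<Delta>4 m4 e4 s4 where 2:
    "\<Delta>3 \<tturnstile>(m3,e3,s3) u : M" "\<Delta>4 \<tturnstile>(m4,e4,s4) u : N"
    "\<Delta>2 = \<Delta>3 + \<Delta>4" "m2 = m3 + m4" "e2 = e3 + e4" "s2 = s3 + s4"
    using add.IH[OF _ 1(2)] by blast
  show ?case
    using add.prems(1)[OF multi_add[OF 1(1) 2(1)] 2(2)] 1 2 by (simp add: ac_simps)
qed

lemma multi_typing_sum:
  assumes "finite I" "\<And>i. i \<in> I \<Longrightarrow> \<Delta> i \<turnstile>(m i,e i,s i) u : \<sigma> i"
  shows "sum \<Delta> I \<tturnstile>(sum m I,sum e I,sum s I) u : {#\<sigma> i. i \<in># mset_set I#}"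
  using assms by (induction rule: finite_induct) (auto intro: multi_typing.intros)

text \<open>Converse of \<open>multi_typing_sum\<close>, with an initial segment of the naturals as
  index set; it supplies the families that \<open>app_c\<close> and \<open>es_c\<close> ask
  for.\<close>

lemma multi_typing_family:
  assumes "\<Delta> \<tturnstile>(m,e,s) u : M"
  obtains n :: nat and \<Delta>' m' e' s' \<sigma> where
    "\<And>i. i < n \<Longrightarrow> \<Delta>' i \<turnstile>(m' i,e' i,s' i) u : \<sigma> i"
    "M = {#\<sigma> i. i \<in># mset_set {..<n}#}"
    "\<Delta> = sum \<Delta>' {..<n}" "m = sum m' {..<n}" "e = sum e' {..<n}" "s = sum s' {..<n}"
  using assms
proof (induction arbitrary: thesis rule: multi_typing.induct)
  case (multi_empty u)
  show ?case by (rule multi_empty[of 0]) auto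
next
  case (multi_add \<Delta>0 m0 e0 s0 u \<sigma>0 \<Delta>1 m1 e1 s1 M)
  obtain n :: nat and \<Delta>' m' e' s' \<sigma> where 1:
    "\<And>i. i < n \<Longrightarrow> \<Delta>' i \<turnstile>(m' i,e' i,s' i) u : \<sigma> i"
    "M = {#\<sigma> i. i \<in># mset_set {..<n}#}"
    "\<Delta>1 = sum \<Delta>' {..<n}" "m1 = sum m' {..<n}" "e1 = sum e' {..<n}" "s1 = sum s' {..<n}"
    using multi_add.IH by blast
  \<comment> \<open>The new derivation is stored at index \<open>n\<close>, outside
    \<open>{..<n}\<close>, so the entries already there keep their values.\<close>
  have upd: "sum (f(n := a)) {..<Suc n} = a + sum f {..<n}"
    for f :: "nat \<Rightarrow> 'a::comm_monoid_add" and a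
    by (simp add: ac_simps)
  have M: "{#(\<sigma>(n := \<sigma>0)) i. i \<in># mset_set {..<Suc n}#} = add_mset \<sigma>0 M"
    unfolding 1(2) by (auto simp: lessThan_Suc intro!: image_mset_cong)
  show ?case
    by (rule multi_add.prems[of "Suc n" "\<Delta>'(n := \<Delta>0)" "m'(n := m0)" "e'(n := e0)"
          "s'(n := s0)" "\<sigma>(n := \<sigma>0)"], unfold upd M)
      (use 1 multi_add.hyps(1) in \<open>auto simp: less_Suc_eq\<close>)
qed

section \<open>Application and explicit substitution typed through multitypings\<close>

lemma ctx_add_sum_conv: "ctx_add_sum \<Gamma> I \<Delta> = \<Gamma> + sum \<Delta> I"
proof
  fix x
  have "sum \<Delta> I x = (\<Sum>i\<in>I. \<Delta> i x)"
    by (induction I rule: infinite_finite_induct) auto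
  then show "ctx_add_sum \<Gamma> I \<Delta> x = (\<Gamma> + sum \<Delta> I) x" by (simp add: ctx_add_sum_def)
qed

lemma typing_App:
  assumes "\<Gamma> \<turnstile>(m,e,s) t : Arr M \<tau>" "\<Delta> \<tturnstile>(m',e',s') u : M"
  shows "\<Gamma> + \<Delta> \<turnstile>(1 + m + m',1 + e + e',s + s') App t u : \<tau>"
  using assms(2)
proof (cases rule: multi_typing_family)
  case (1 n \<Delta>' m' e' s' \<sigma>)
  then show ?thesis
    using app_c[of "{..<n}" \<Gamma> m e s t \<sigma> \<tau> \<Delta>' m' e' s' u] assms(1)
    by (simp add: ctx_add_sum_conv)
qed

lemma typing_ES:
  assumes "ctx_cons M \<Gamma> \<turnstile>(m,e,s) t : \<tau>" "\<Delta> \<tturnstile>(m',e',s') u : M"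
  shows "\<Gamma> + \<Delta> \<turnstile>(m + m',1 + e + e',s + s') ES t u : \<tau>"
  using assms(2)
proof (cases rule: multi_typing_family)
  case (1 n \<Delta>' m' e' s' \<sigma>)
  then show ?thesis
    using es_c[of "{..<n}" \<sigma> \<Gamma> m e s t \<tau> \<Delta>' m' e' s' u] assms(1)
    by (simp add: ctx_add_sum_conv)
qed

section \<open>Inversion of the typing rules\<close>

inductive_cases typing_VarE: "\<Gamma> \<turnstile>(m,e,s) Var x : \<sigma>"
inductive_cases typing_LamE: "\<Gamma> \<turnstile>(m,e,s) Lam t : \<sigma>"

lemma typing_AppE:
  assumes "\<Gamma> \<turnstile>(m,e,s) App t u : \<sigma>"
  obtains (app_p) s' where "\<sigma> = Tight TN" "s = s' + 1" "\<Gamma> \<turnstile>(m,e,s') t : Tight TN"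
  | (app_c) \<Gamma>1 m1 e1 s1 M \<Delta> m2 e2 s2 where
    "\<Gamma>1 \<turnstile>(m1,e1,s1) t : Arr M \<sigma>" "\<Delta> \<tturnstile>(m2,e2,s2) u : M"
    "\<Gamma> = \<Gamma>1 + \<Delta>" "m = 1 + m1 + m2" "e = 1 + e1 + e2" "s = s1 + s2"
  using assms
proof (cases rule: typing.cases)
  case (app_p s0)
  with that(1)[of s0] show ?thesis by simp
next
  case (app_c I \<Gamma>0 m0 e0 s0 \<sigma>' \<Delta> m' e' s')
  show ?thesis
    by (rule that(2)[OF app_c(6) multi_typing_sum[OF app_c(5,7)]])
      (use app_c(1-4) in \<open>simp_all add: ctx_add_sum_conv\<close>)
qed

lemma typing_ESE:
  assumes "\<Gamma> \<turnstile>(m,e,s) ES t u : \<sigma>"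
  obtains \<Gamma>1 m1 e1 s1 M \<Delta> m2 e2 s2 where
    "ctx_cons M \<Gamma>1 \<turnstile>(m1,e1,s1) t : \<sigma>" "\<Delta> \<tturnstile>(m2,e2,s2) u : M"
    "\<Gamma> = \<Gamma>1 + \<Delta>" "m = m1 + m2" "e = 1 + e1 + e2" "s = s1 + s2"
  using assms
proof (cases rule: typing.cases)
  case (es_c I \<sigma>' \<Gamma>0 m0 e0 s0 \<Delta> m' e' s')
  show ?thesis
    by (rule that[OF es_c(6) multi_typing_sum[OF es_c(5,7)]])
      (use es_c(1-4) in \<open>simp_all add: ctx_add_sum_conv\<close>)
qed

section \<open>Lifting and substitution\<close>

text \<open>Context counterpart of \<open>lift _ k\<close>: the fresh index \<open>k\<close> gets
  the empty multitype.\<close>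

definition ctx_insert :: "nat \<Rightarrow> ctx \<Rightarrow> ctx" where
  "ctx_insert k \<Gamma> = (\<lambda>x. if x < k then \<Gamma> x else if x = k then {#} else \<Gamma> (x - 1))"

text \<open>Context counterpart of \<open>subst _ _ k\<close>, which removes index \<open>k\<close>
  and closes the gap.\<close>

definition ctx_delete :: "nat \<Rightarrow> ctx \<Rightarrow> ctx" where
  "ctx_delete k \<Gamma> = (\<lambda>x. if x < k then \<Gamma> x else \<Gamma> (Suc x))"

lemma ctx_insert_zero [simp]: "ctx_insert k 0 = 0"
  by (auto simp: ctx_insert_def)

lemma ctx_insert_Suc_0 [simp]: "ctx_insert (Suc k) \<Gamma> 0 = \<Gamma> 0"
  by (simp add: ctx_insert_def)

text \<open>Under a binder the substituted term is lifted and so contributes nothing at index 0: the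
  multitype of the bound variable is preserved.\<close>

lemma ctx_delete_insert_0 [simp]: "(ctx_delete (Suc k) \<Gamma> + ctx_insert 0 \<Delta>) 0 = \<Gamma> 0"
  by (simp add: ctx_delete_def ctx_insert_def)

lemma ctx_insert_plus: "ctx_insert k (\<Gamma> + \<Delta>) = ctx_insert k \<Gamma> + ctx_insert k \<Delta>"
  by (auto simp: ctx_insert_def)

lemma ctx_insert_tail: "ctx_insert k (ctx_tail \<Gamma>) = ctx_tail (ctx_insert (Suc k) \<Gamma>)"
  by (auto simp: ctx_insert_def ctx_tail_def fun_eq_iff intro!: arg_cong[of _ _ \<Gamma>])

lemma ctx_insert_cons: "ctx_insert (Suc k) (ctx_cons M \<Gamma>) = ctx_cons M (ctx_insert k \<Gamma>)"
  by (auto simp: ctx_insert_def ctx_cons_def fun_eq_iff split: nat.split)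

lemma ctx_delete_zero [simp]: "ctx_delete k 0 = 0"
  by (auto simp: ctx_delete_def)

lemma ctx_delete_plus: "ctx_delete k (\<Gamma> + \<Delta>) = ctx_delete k \<Gamma> + ctx_delete k \<Delta>"
  by (auto simp: ctx_delete_def)

lemma ctx_delete_tail:
  "ctx_delete k (ctx_tail \<Gamma>) + \<Delta> = ctx_tail (ctx_delete (Suc k) \<Gamma> + ctx_insert 0 \<Delta>)"
  by (auto simp: ctx_delete_def ctx_insert_def ctx_tail_def)

lemma ctx_delete_cons:
  "ctx_delete (Suc k) (ctx_cons M \<Gamma>) + ctx_insert 0 \<Delta> = ctx_cons M (ctx_delete k \<Gamma> + \<Delta>)"
  by (auto simp: ctx_delete_def ctx_insert_def ctx_cons_def fun_eq_iff split: nat.split)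

text \<open>The first assumption is the induction hypothesis for an argument \<open>u\<close> in
  \<open>typing_lift\<close>; it is carried over to multitypes here, which avoids a mutual
  induction.\<close>

lemma multi_typing_lift_aux:
  assumes "\<And>\<Gamma> m e s \<sigma>. \<Gamma> \<turnstile>(m,e,s) u : \<sigma> \<Longrightarrow> ctx_insert k \<Gamma> \<turnstile>(m,e,s) lift u k : \<sigma>"
    and "\<Delta> \<tturnstile>(m,e,s) u : M"
  shows "ctx_insert k \<Delta> \<tturnstile>(m,e,s) lift u k : M"
  using assms(2,1)
  by (induction rule: multi_typing.induct) (auto simp: ctx_insert_plus intro: multi_typing.intros)

lemma typing_lift:
  "\<Gamma> \<turnstile>(m,e,s) t : \<sigma> \<Longrightarrow> ctx_insert k \<Gamma> \<turnstile>(m,e,s) lift t k : \<sigma>"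
proof (induction t arbitrary: \<Gamma> m e s \<sigma> k)
  case (Var i)
  have "ctx_insert k (ctx_single i \<sigma>) = ctx_single (if i < k then i else Suc i) \<sigma>"
    by (auto simp: ctx_insert_def ctx_single_def fun_eq_iff)
  with Var show ?case by (auto elim!: typing_VarE) (metis var_c)+
next
  case (Lam t)
  from Lam.prems show ?case
  proof (cases rule: typing.cases)
    case (abs_p \<Gamma>' s' tt)
    with typing.abs_p[OF Lam.IH[OF abs_p(4), of "Suc k"]] show ?thesis
      by (simp add: ctx_insert_tail)
  next
    case (abs_c \<Gamma>' \<tau>)
    with typing.abs_c[OF Lam.IH[OF abs_c(3), of "Suc k"]] show ?thesis
      by (simp add: ctx_insert_tail)
  qed
next
  case (App t u)
  from App.prems show ?case
  proof (cases rule: typing_AppE)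
    case (app_p s')
    then show ?thesis using typing.app_p[OF App.IH(1)] by auto
  next
    case (app_c \<Gamma>1 m1 e1 s1 M \<Delta> m2 e2 s2)
    then show ?thesis
      using typing_App[OF App.IH(1)[OF app_c(1)] multi_typing_lift_aux[OF App.IH(2) app_c(2)]]
      by (simp add: ctx_insert_plus del: plus_fun_apply)
  qed
next
  case (ES t u)
  from ES.prems show ?case
  proof (cases rule: typing_ESE)
    case (1 \<Gamma>1 m1 e1 s1 M \<Delta> m2 e2 s2)
    then show ?thesis
      using typing_ES[OF ES.IH(1)[OF 1(1), of "Suc k", unfolded ctx_insert_cons]
          multi_typing_lift_aux[OF ES.IH(2) 1(2)]]
      by (simp add: ctx_insert_plus del: plus_fun_apply)
  qed
qed

lemma multi_typing_lift:
  "\<Delta> \<tturnstile>(m,e,s) u : M \<Longrightarrow> ctx_insert k \<Delta> \<tturnstile>(m,e,s) lift u k : M"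
  using multi_typing_lift_aux typing_lift by blast

text \<open>Plays the same part for \<open>typing_subst\<close>. Each derivation of \<open>r\<close>
  takes the share of the derivations of \<open>u\<close> that its own context demands at
  \<open>k\<close>.\<close>

lemma multi_typing_subst_aux:
  assumes "\<And>\<Gamma> m e s \<sigma> \<Delta> m' e' s'. \<Gamma> \<turnstile>(m,e,s) r : \<sigma> \<Longrightarrow> \<Delta> \<tturnstile>(m',e',s') u : \<Gamma> k \<Longrightarrow>
      ctx_delete k \<Gamma> + \<Delta> \<turnstile>(m + m',e + e',s + s') subst r u k : \<sigma>"
    and "\<Gamma> \<tturnstile>(m,e,s) r : M" "\<Delta> \<tturnstile>(m',e',s') u : \<Gamma> k"
  shows "ctx_delete k \<Gamma> + \<Delta> \<tturnstile>(m + m',e + e',s + s') subst r u k : M"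
  using assms(2,1,3)
proof (induction arbitrary: \<Delta> m' e' s' rule: multi_typing.induct)
  case (multi_empty r)
  from multi_empty(2) have "\<Delta> = 0" "m' = 0" "e' = 0" "s' = 0"
    by (auto elim: multi_emptyE)
  then show ?case
    using multi_typing.multi_empty by (simp only: ctx_delete_zero add_0)
next
  case (multi_add \<Gamma>1 m1 e1 s1 r \<sigma> \<Gamma>2 m2 e2 s2 M)
  from multi_add.prems(2) have "\<Delta> \<tturnstile>(m',e',s') u : \<Gamma>1 k + \<Gamma>2 k" by simp
  then show ?case
  proof (cases rule: multi_typing_plusE)
    case (1 \<Delta>1 m1 e1 s1 \<Delta>2 m2 e2 s2)
    show ?thesis
      using multi_typing.multi_add[OF multi_add.prems(1)[OF multi_add.hyps(1) 1(1)]
          multi_add.IH[OF multi_add.prems(1) 1(2)]] 1(3-)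
      by (simp add: ctx_delete_plus ac_simps del: plus_fun_apply)
  qed
qed

text \<open>Each \<open>var_c\<close> leaf for \<open>k\<close> accounts for one element of
  \<open>\<Gamma> k\<close> and is replaced by one derivation of \<open>u\<close>. Nothing is
  duplicated or erased, so the counters add up exactly.\<close>

lemma typing_subst:
  "\<Gamma> \<turnstile>(m,e,s) t : \<sigma> \<Longrightarrow> \<Delta> \<tturnstile>(m',e',s') u : \<Gamma> k \<Longrightarrow>
   ctx_delete k \<Gamma> + \<Delta> \<turnstile>(m + m',e + e',s + s') subst t u k : \<sigma>"
proof (induction t arbitrary: \<Gamma> m e s \<sigma> \<Delta> m' e' s' u k)
  case (Var i)
  from Var(1) have \<Gamma>: "\<Gamma> = ctx_single i \<sigma>" "m = 0" "e = 0" "s = 0"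
    by (auto elim: typing_VarE)
  show ?case
  proof (cases "i = k")
    case True
    then have "ctx_delete k \<Gamma> = 0" "\<Gamma> k = {#\<sigma>#}"
      using \<Gamma> by (auto simp: ctx_delete_def ctx_single_def)
    then show ?thesis using Var(2) \<Gamma> True by (auto intro: multi_typing_singleD)
  next
    case False
    then have "\<Gamma> k = {#}"
      using \<Gamma> by (auto simp: ctx_single_def)
    with Var(2) have "\<Delta> = 0" "m' = 0" "e' = 0" "s' = 0" by (auto elim: multi_emptyE)
    moreover have "ctx_delete k \<Gamma> = ctx_single (if k < i then i - 1 else i) \<sigma>"
      using \<Gamma> False by (auto simp: ctx_delete_def ctx_single_def fun_eq_iff)
    ultimately show ?thesis using False \<Gamma> var_c by auto
  qed
next
  case (Lam t)
  from Lam.prems(1) show ?case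
  proof (cases rule: typing.cases)
    case (abs_p \<Gamma>' s0 tt)
    have "ctx_insert 0 \<Delta> \<tturnstile>(m',e',s') lift u 0 : \<Gamma>' (Suc k)"
      using multi_typing_lift[OF Lam.prems(2)] abs_p by (simp add: ctx_tail_def)
    from typing.abs_p[OF Lam.IH[OF abs_p(4) this]] abs_p show ?thesis
      by (simp add: ctx_delete_tail del: plus_fun_apply)
  next
    case (abs_c \<Gamma>' \<tau>)
    have "ctx_insert 0 \<Delta> \<tturnstile>(m',e',s') lift u 0 : \<Gamma>' (Suc k)"
      using multi_typing_lift[OF Lam.prems(2)] abs_c by (simp add: ctx_tail_def)
    from typing.abs_c[OF Lam.IH[OF abs_c(3) this]] abs_c show ?thesis
      by (simp add: ctx_delete_tail del: plus_fun_apply)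
  qed
next
  case (App t r)
  from App.prems(1) show ?case
  proof (cases rule: typing_AppE)
    case (app_p s0)
    then show ?thesis using typing.app_p[OF App.IH(1)[OF app_p(3) App.prems(2)]] by simp
  next
    case (app_c \<Gamma>1 m1 e1 s1 M \<Gamma>2 m2 e2 s2)
    then have "\<Delta> \<tturnstile>(m',e',s') u : \<Gamma>1 k + \<Gamma>2 k" using App.prems(2) by simp
    then show ?thesis
    proof (cases rule: multi_typing_plusE)
      case (1 \<Delta>1 m1 e1 s1 \<Delta>2 m2 e2 s2)
      show ?thesis
        using typing_App[OF App.IH(1)[OF app_c(1) 1(1)]
            multi_typing_subst_aux[OF App.IH(2) app_c(2) 1(2)]] 1(3-) app_c(3-)
        by (simp add: ctx_delete_plus ac_simps del: plus_fun_apply)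
    qed
  qed
next
  case (ES t r)
  from ES.prems(1) show ?case
  proof (cases rule: typing_ESE)
    case (1 \<Gamma>1 m1 e1 s1 M \<Gamma>2 m2 e2 s2)
    then have "\<Delta> \<tturnstile>(m',e',s') u : \<Gamma>1 k + \<Gamma>2 k" using ES.prems(2) by simp
    then show ?thesis
    proof (cases rule: multi_typing_plusE)
      case 2: (1 \<Delta>1 m1 e1 s1 \<Delta>2 m2 e2 s2)
      \<comment> \<open>The share of the body crosses the binder: \<open>u\<close> is lifted and
        index \<open>k\<close> becomes \<open>Suc k\<close>.\<close>
      have "ctx_insert 0 \<Delta>1 \<tturnstile>(m1,e1,s1) lift u 0 : ctx_cons M \<Gamma>1 (Suc k)"
        using multi_typing_lift[OF 2(1)] by (simp add: ctx_cons_def)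
      from typing_ES[OF ES.IH(1)[OF 1(1) this, unfolded ctx_delete_cons]
          multi_typing_subst_aux[OF ES.IH(2) 1(2) 2(2)]] 1(3-) 2(3-)
      show ?thesis by (simp add: ctx_delete_plus ac_simps del: plus_fun_apply)
    qed
  qed
qed

section \<open>Progress and subject reduction\<close>

lemma mstep_App: "mstep t t' \<Longrightarrow> mstep (App t u) (App t' u)"
  by (auto elim!: mstep.cases) (metis mstep.intros nplug.simps(2))

lemma estep_App: "estep t t' \<Longrightarrow> estep (App t u) (App t' u)"
  by (auto elim!: estep.cases) (metis estep.intros nplug.simps(2))

lemma mstep_Lam: "mstep t t' \<Longrightarrow> mstep (Lam t) (Lam t')"
  by (auto elim!: mstep.cases) (metis mstep.intros nplug.simps(3))

lemma estep_Lam: "estep t t' \<Longrightarrow> estep (Lam t) (Lam t')"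
  by (auto elim!: estep.cases) (metis estep.intros nplug.simps(3))

lemma mstep_beta: "mstep (App (Lam t) u) (ES t u)"
  using mstep.intros[OF dB.intros[of LHole t u], of NHole] by simp

lemma estep_ES: "estep (ES t u) (subst t u 0)"
  using estep.intros[OF sn.intros, of NHole] by simp

text \<open>\<open>abs_c\<close> splits the context of the body into head and tail;
  \<open>es_c\<close> wants the two joined again when a \<open>dB\<close> redex is
  contracted.\<close>

lemma ctx_cons_tail: "ctx_cons (\<Gamma> 0) (ctx_tail \<Gamma>) = \<Gamma>"
  by (auto simp: ctx_cons_def ctx_tail_def fun_eq_iff split: nat.split)

text \<open>The charges of the rules match the steps: \<open>app_c\<close> pays 1 in
  \<open>m\<close> and 1 in \<open>e\<close>, \<open>es_c\<close> only 1 in \<open>e\<close>. A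
  \<open>dB\<close> step turns the former rule into the latter and saves the multiplicative unit; an
  \<open>sn\<close> step removes \<open>es_c\<close> and saves the exponential one.\<close>

lemma progress_subject_reduction:
  assumes "\<Gamma> \<turnstile>(m,e,s) t : \<sigma>"
  obtains (normal) "t \<in> no\<^sub>n"
  | (mult) m' t' where "m = Suc m'" "mstep t t'" "\<Gamma> \<turnstile>(m',e,s) t' : \<sigma>"
  | (exp) e' t' where "e = Suc e'" "estep t t'" "\<Gamma> \<turnstile>(m,e',s) t' : \<sigma>"
  using assms
proof (induction t arbitrary: \<Gamma> m e s \<sigma> thesis)
  case (Var i)
  then show ?case by (blast intro: no_ne ne_var)
next
  case (Lam t)
  from Lam.prems(4) show ?case
  proof (cases rule: typing.cases)
    case (abs_p \<Gamma>' s' tt)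
    show ?thesis
    proof (rule Lam.IH[OF _ _ _ abs_p(4)])
      assume "t \<in> no\<^sub>n"
      then show ?thesis using Lam.prems(1) no_lam by blast
    next
      fix m' t' assume "m = Suc m'" "mstep t t'" "\<Gamma>' \<turnstile>(m',e,s') t' : Tight tt"
      then show ?thesis using Lam.prems(2) mstep_Lam typing.abs_p abs_p by metis
    next
      fix e' t' assume "e = Suc e'" "estep t t'" "\<Gamma>' \<turnstile>(m,e',s') t' : Tight tt"
      then show ?thesis using Lam.prems(3) estep_Lam typing.abs_p abs_p by metis
    qed
  next
    case (abs_c \<Gamma>' \<tau>)
    show ?thesis
    proof (rule Lam.IH[OF _ _ _ abs_c(3)])
      assume "t \<in> no\<^sub>n"
      then show ?thesis using Lam.prems(1) no_lam by blast
    next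
      fix m' t' assume "m = Suc m'" "mstep t t'" "\<Gamma>' \<turnstile>(m',e,s) t' : \<tau>"
      then show ?thesis using Lam.prems(2) mstep_Lam typing.abs_c abs_c by metis
    next
      fix e' t' assume "e = Suc e'" "estep t t'" "\<Gamma>' \<turnstile>(m,e',s) t' : \<tau>"
      then show ?thesis using Lam.prems(3) estep_Lam typing.abs_c abs_c by metis
    qed
  qed
next
  case (App t u)
  from App.prems(4) show ?case
  proof (cases rule: typing_AppE)
    case (app_p s')
    show ?thesis
    proof (rule App.IH(1)[OF _ _ _ app_p(3)])
      assume "t \<in> no\<^sub>n"
      then show ?thesis
      proof (cases rule: no\<^sub>n.cases)
        case (no_lam t0)
        \<comment> \<open>An abstraction only gets type \<open>Tight TA\<close> or an arrow, so
          \<open>app_p\<close> never types a \<open>dB\<close> redex.\<close>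
        then show ?thesis using app_p(3) by (auto elim: typing_LamE)
      next
        case no_ne
        then show ?thesis using App.prems(1) by (blast intro: ne\<^sub>n_no\<^sub>n.intros)
      qed
    next
      fix m' t' assume "m = Suc m'" "mstep t t'" "\<Gamma> \<turnstile>(m',e,s') t' : Tight TN"
      then show ?thesis using App.prems(2) mstep_App typing.app_p app_p by metis
    next
      fix e' t' assume "e = Suc e'" "estep t t'" "\<Gamma> \<turnstile>(m,e',s') t' : Tight TN"
      then show ?thesis using App.prems(3) estep_App typing.app_p app_p by metis
    qed
  next
    case (app_c \<Gamma>1 m1 e1 s1 M \<Delta> m2 e2 s2)
    show ?thesis
    proof (rule App.IH(1)[OF _ _ _ app_c(1)])
      assume "t \<in> no\<^sub>n"
      then show ?thesis
      proof (cases rule: no\<^sub>n.cases)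
        case (no_lam t0)
        from app_c(1)[unfolded no_lam(1)]
        obtain \<Gamma>' where \<Gamma>': "\<Gamma>1 = ctx_tail \<Gamma>'" "M = \<Gamma>' 0" "\<Gamma>' \<turnstile>(m1,e1,s1) t0 : \<sigma>"
          by (auto elim: typing_LamE)
        \<comment> \<open>The unit of \<open>es_c\<close> takes the place of the exponential unit of
          \<open>app_c\<close>, hence \<open>e\<close> is unchanged.\<close>
        have 1: "\<Gamma> \<turnstile>(m1 + m2,e,s) ES t0 u : \<sigma>"
          using typing_ES[of M \<Gamma>1 m1 e1 s1 t0 \<sigma> \<Delta>] \<Gamma>' app_c by (simp add: ctx_cons_tail)
        show ?thesis
          by (rule App.prems(2)[OF _ _ 1]) (simp_all add: no_lam(1) app_c(4) mstep_beta)
      next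
        case no_ne
        then show ?thesis using App.prems(1) by (blast intro: ne\<^sub>n_no\<^sub>n.intros)
      qed
    next
      fix m' t' assume 1: "m1 = Suc m'" "mstep t t'" "\<Gamma>1 \<turnstile>(m',e1,s1) t' : Arr M \<sigma>"
      from typing_App[OF 1(3) app_c(2)] app_c 1 show ?thesis
        \<comment> \<open>The step is inside \<open>t\<close>, so the multiplicative unit of
          \<open>app_c\<close> itself remains: this is the final \<open>+ 1\<close>.\<close>
        by (intro App.prems(2)[OF _ mstep_App[OF 1(2)], of "m' + m2 + 1"])
          (auto simp del: plus_fun_apply)
    next
      fix e' t' assume 1: "e1 = Suc e'" "estep t t'" "\<Gamma>1 \<turnstile>(m1,e',s1) t' : Arr M \<sigma>"
      from typing_App[OF 1(3) app_c(2)] app_c 1 show ?thesis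
        by (intro App.prems(3)[OF _ estep_App[OF 1(2)], of "e' + e2 + 1"])
          (auto simp del: plus_fun_apply)
    qed
  qed
next
  case (ES t u)
  from ES.prems(4) show ?case
  proof (cases rule: typing_ESE)
    \<comment> \<open>The substitution is executed at once, whether or not its body is normal, so no
      induction hypothesis enters.\<close>
    case (1 \<Gamma>1 m1 e1 s1 M \<Delta> m2 e2 s2)
    have "\<Delta> \<tturnstile>(m2,e2,s2) u : ctx_cons M \<Gamma>1 0"
      using 1(2) by (simp add: ctx_cons_def)
    moreover have "ctx_delete 0 (ctx_cons M \<Gamma>1) = \<Gamma>1"
      by (simp add: ctx_delete_def ctx_cons_def)
    ultimately have 2: "\<Gamma> \<turnstile>(m,e1 + e2,s) subst t u 0 : \<sigma>"
      using typing_subst[OF 1(1)] 1(3-) by metis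
    show ?thesis
      by (rule ES.prems(3)[OF _ estep_ES 2]) (simp add: 1(5))
  qed
qed

section \<open>Tight derivations of normal forms\<close>

text \<open>The tight context gives the head variable a tight type, and tightness spreads along the
  spine: a tight type is no arrow, so each application is typed by \<open>app_p\<close> and adds 1
  to \<open>s\<close> alone.\<close>

lemma tight_neutral:
  "t \<in> ne\<^sub>n \<Longrightarrow> \<Gamma> \<turnstile>(m,e,s) t : \<sigma> \<Longrightarrow> tight_ctx \<Gamma> \<Longrightarrow>
   tight_ty \<sigma> \<and> m = 0 \<and> e = 0 \<and> s = nsize t"
proof (induction t arbitrary: \<Gamma> m e s \<sigma>)
  case (Var i)
  then show ?case
    by (auto elim!: typing_VarE simp: tight_ctx_def tight_multi_def ctx_single_def split: if_splits)
next
  case (App t u)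
  from App.prems(1) have t: "t \<in> ne\<^sub>n" by cases
  from App.prems(2) show ?case
  proof (cases rule: typing_AppE)
    case (app_p s')
    then show ?thesis using App.IH(1)[OF t app_p(3) App.prems(3)] by (simp add: tight_ty_def)
  next
    case (app_c \<Gamma>1 m1 e1 s1 M \<Delta> m2 e2 s2)
    then have "tight_ctx \<Gamma>1"
      using App.prems(3) by (auto simp: tight_ctx_def tight_multi_def)
    \<comment> \<open>Contradiction: the induction hypothesis makes the arrow type of
      \<open>t\<close> tight.\<close>
    from App.IH(1)[OF t app_c(1) this] show ?thesis by (simp add: tight_ty_def)
  qed
qed (auto elim: ne\<^sub>n.cases)

text \<open>A tight type forces \<open>abs_p\<close> on every outer abstraction, which adds 1 to
  \<open>s\<close>; below these abstractions the term is neutral.\<close>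

lemma tight_normal:
  "t \<in> no\<^sub>n \<Longrightarrow> \<Gamma> \<turnstile>(m,e,s) t : \<sigma> \<Longrightarrow> tight_ctx \<Gamma> \<Longrightarrow> tight_ty \<sigma> \<Longrightarrow>
   m = 0 \<and> e = 0 \<and> s = nsize t"
proof (induction t arbitrary: \<Gamma> m e s \<sigma>)
  case (Lam t)
  from Lam.prems(1) have t: "t \<in> no\<^sub>n" by cases (auto elim: ne\<^sub>n.cases)
  from Lam.prems(2,4) obtain \<Gamma>' s' tt where 1:
    "\<Gamma> = ctx_tail \<Gamma>'" "s = s' + 1" "tight_multi (\<Gamma>' 0)" "\<Gamma>' \<turnstile>(m,e,s') t : Tight tt"
    by (auto elim!: typing_LamE simp: tight_ty_def)
  \<comment> \<open>The side condition of \<open>abs_p\<close> covers index 0, the tightness of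
    \<open>\<Gamma>\<close> all other indices.\<close>
  have "tight_ctx \<Gamma>'"
    using Lam.prems(3) 1(1,3) unfolding tight_ctx_def ctx_tail_def by (metis not0_implies_Suc)
  from Lam.IH[OF t 1(4) this] show ?case by (simp add: 1 tight_ty_def)
qed (blast elim: no\<^sub>n.cases dest: tight_neutral)+

theorem theorem3p6:
  fixes \<Gamma> :: ctx and t :: trm and \<sigma> :: ty and m e s :: nat
  assumes "\<Gamma> \<turnstile>(m,e,s) t : \<sigma>"
    and "tight_ctx \<Gamma>" and "tight_ty \<sigma>"
  shows "\<exists>p \<in> no\<^sub>n. t \<rightarrow>\<^sub>n(m,e) p \<and> nsize p = s"
  using assms(1)
\<comment> \<open>\<open>\<Gamma>\<close>, \<open>\<sigma>\<close> and \<open>s\<close> stay fixed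
  along the reduction, so the tightness assumptions still hold at the normal form.\<close>
proof (induction "m + e" arbitrary: t m e)
  case 0
  from 0(2) show ?case
  proof (cases rule: progress_subject_reduction)
    case normal
    then show ?thesis using tight_normal[OF normal 0(2) assms(2,3)] nred_refl by auto
  qed (use 0 in auto)
next
  case (Suc n)
  from Suc.prems show ?case
  proof (cases rule: progress_subject_reduction)
    case normal
    \<comment> \<open>Impossible case: a tight derivation of a normal form has
      \<open>m + e = 0\<close>.\<close>
    then show ?thesis using tight_normal Suc assms by fastforce
  next
    case (mult m' t')
    with Suc.hyps(1)[of m' e t'] Suc.hyps(2) show ?thesis by (auto intro: nred_m)
  next
    case (exp e' t')
    with Suc.hyps(1)[of m e' t'] Suc.hyps(2) show ?thesis by (auto intro: nred_e)
  qed
qed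

end
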